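(* Let $(A;*,\bullet,\{a_n\})$ be a marked Kauffman bracket magma such that $a_n=a_{n+2}$ for all $n\in\mathbb{N}$ and $(a*b)\bullet(c*d)=(a\bullet c)*(b\bullet d)$ for all $a,b,c,d\in A$, so that $P_M:\mathcal{F}\to A$ is invariant under Yoshikawa moves except $\Gamma_1$, $\Gamma_6$ and $\Gamma_6'$. Let $\mathrm{Map}(A)$ be the set of maps from $A$ to itself. Assume that there is a map $\phi:\mathcal{F}\to \mathrm{Map}(A)$, written $\phi(D)=\phi_D$, which is invariant under Yoshikawa moves except $\Gamma_1$, $\Gamma_6$ and $\Gamma_6'$, and such that $$\phi_D(P_M(D))=\phi_{D'}(P_M(D'))$$ whenever $D'$ is obtained from $D$ by applying once one of the Yoshikawa moves $\Gamma_6$ and $\Gamma_6'$. Then there exists a function $P_M^{\phi}:\mathcal{F}\to A$, defined by $P_M^{\phi}(D)=\phi_D(P_M(D))$ for each marked graph diagram $D\in\mathcal{F}$, which is invariant under all Yoshikawa moves except $\Gamma_1$.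
   Context: Algebra. $\mathbb{N}=\{1,2,3,\dots\}$. A magma $(A;\star)$ is entropic if $(a\star b)\star(c\star d)=(a\star c)\star(b\star d)$ for all $a,b,c,d\in A$. A Kauffman bracket magma $(A;*,\{a_n\})$ is an entropic magma $(A;* )$ with a sequence $\{a_n\}_{n=1}^\infty$ in $A$ such that for all $n\in\mathbb{N}$: $(a_{n+1}*a_{n+2})*(a_n*a_{n+1})=a_n$ and $(a_n*a_{n+1})*(a_{n+1}*a_n)=a_{n+1}$. A marked Kauffman bracket magma $(A;*,\bullet,\{a_n\})$ is a Kauffman bracket magma $(A;*,\{a_n\})$ with a further binary operation $\bullet$ on $A$ such that $(A;\bullet)$ is entropic. The invariant $P$. For an unoriented link diagram $D$ with a chosen crossing, $D_0$ is the result of the $A$-smoothing (joining the two regions swept out when the overstrand is rotated counterclockwise) and $D_\infty$ that of the other smoothing. By a theorem of Niebrzydowski–Przytycki, there is a unique $A$-valued function $P$ of unoriented link diagrams, invariant under planar isotopy and Reidemeister moves II and III, with $P(T_n)=a_n$ for the crossingless diagram $T_n$ with $n$ components and $P(D)=P(D_0)*P(D_\infty)$ at every crossing. Marked graph diagrams. A marked graph diagram is a link diagram in $\mathbb{R}^2$ that may in addition have 4-valent marked vertices, each decorated by a marker, a short segment through the vertex lying in two opposite of the four adjacent corner regions. Splicing a marked vertex $m$ of $D$ means: $D^m_\infty$ is obtained by the smoothing that merges the two corner regions containing the ends of the marker, $D^m_0$ by the other smoothing. Applying the $\infty$-smoothing (resp. the $0$-smoothing) at all marked vertices gives the positive resolution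 $L_+(D)$ (resp. negative resolution $L_-(D)$). $D$ is admissible if both $L_+(D)$ and $L_-(D)$ are diagrams of trivial links. $\mathcal{F}$ is the set of admissible marked graph diagrams. The function $P_M$. It is defined (recursively, on all marked graph diagrams and hence on $\mathcal{F}$) by $P_M(D)=P(D)$ if $D$ has no markers, and $P_M(D)=P_M(D^m_\infty)\bullet P_M(D^m_0)$ for any marked vertex $m$ of $D$; the value is independent of the order in which markers are spliced. Invariance of a function $f$ on $\mathcal{F}$ under a move means $f(D)=f(D')$ whenever $D,D'\in\mathcal{F}$ differ by planar isotopy or by one application of the move. Yoshikawa moves are the moves $\Gamma_1,\Gamma_2,\Gamma_3,\Gamma_4,\Gamma_4',\Gamma_5,\Gamma_6,\Gamma_6',\Gamma_7,\Gamma_8$ (local, in a disc). $\Gamma_1,\Gamma_2,\Gamma_3$: Reidemeister moves I, II, III at classical crossings. $\Gamma_4$ (resp. $\Gamma_4'$): an arc passing over (resp. under) two adjacent edges at a marked vertex is slid across the vertex so as to pass over (resp. under) the other two edges. $\Gamma_5$: a marked vertex (marker horizontal or vertical) whose two left-hand edges cross each other once is replaced by the same marked vertex whose two right-hand edges cross each other once, the new crossing being a translate of the old. $\Gamma_6$: a marked vertex two cyclically adjacent edges of which are joined into a small loop bounding an otherwise empty disc, such that the $\infty$-smoothing yields an arc and a separate small circle, is replaced by a simple arc; $\Gamma_6'$: the same with the $0$-smoothing yielding an arc and a circle. $\Gamma_7$: consider 3-tangles with three vertical strand positions; let $V_1$ have one marked vertex in positions 1,2 (position 3 straight) whose $\infty$-smoothing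 is the identity tangle, and let $W_2$ have one marked vertex in positions 2,3 (position 1 straight) whose $0$-smoothing is the identity tangle; $\Gamma_7$ replaces $V_1$ stacked on $W_2$ by $W_2$ stacked on $V_1$. $\Gamma_8$: consider a horizontal pair of parallel strands crossing a vertical pair of parallel strands in four classical crossings; insert a marked vertex between the two horizontal strands near one end, whose $\infty$-smoothing continues the two strands in parallel, and a marked vertex between the two vertical strands near one end, whose $0$-smoothing continues the two strands in parallel; $\Gamma_8$ replaces the 4-tangle in which the horizontal pair is entirely over the vertical pair by the one in which all four crossings are changed. Each move may be applied in either direction. *)

theory Defs
  imports Main "HOL-Library.FuncSet"
begin

section \<open>Algebra\<close>

definition entropic :: "('a \<Rightarrow> 'a \<Rightarrow> 'a) \<Rightarrow> bool" where
  "entropic f \<longleftrightarrow> (\<forall>a b c d. f (f a b) (f c d) = f (f a c) (f b d))"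

text \<open>The sequence is indexed by the positive integers; the value \<open>a 0\<close> is never used.\<close>

locale kauffman_bracket_magma =
  fixes star :: "'a \<Rightarrow> 'a \<Rightarrow> 'a"
    and a :: "nat \<Rightarrow> 'a"
  assumes star_entropic: "entropic star"
    and bracket1: "n \<ge> 1 \<Longrightarrow> star (star (a (n + 1)) (a (n + 2))) (star (a n) (a (n + 1))) = a n"
    and bracket2: "n \<ge> 1 \<Longrightarrow> star (star (a n) (a (n + 1))) (star (a (n + 1)) (a n)) = a (n + 1)"

locale marked_kauffman_bracket_magma = kauffman_bracket_magma star a
  for star :: "'a \<Rightarrow> 'a \<Rightarrow> 'a" and a :: "nat \<Rightarrow> 'a" +
  fixes bullet :: "'a \<Rightarrow> 'a \<Rightarrow> 'a"
  assumes bullet_entropic: "entropic bullet"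


section \<open>Marked graph diagrams\<close>

text \<open>
  A diagram in general position with respect to the height function of the plane is cut by
  horizontal lines into slices that contain a single minimum, maximum, crossing or marked vertex.
  It is encoded as the list of its slices, read from bottom to top; \<open>(p, i)\<close> is a
  slice whose non-trivial piece \<open>p\<close> has exactly \<open>i\<close> vertical strands on its left.

  A crossing is named after the direction of its overstrand: \<open>SlashOver\<close> means that the
  overstrand runs from bottom left to top right, \<open>BackslashOver\<close> that it runs from bottom
  right to top left.  A marker is \<open>Horizontal\<close> if it lies in the left and right corner
  regions of the vertex, and \<open>Vertical\<close> if it lies in the bottom and top ones.
\<close>

datatype crossing = SlashOver | BackslashOver

datatype marker = Horizontal | Vertical

datatype piece = Cup | Cap | Crossing crossing | Vertex marker

type_synonym slices = "(piece \<times> nat) list"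

fun strands_below :: "piece \<Rightarrow> nat" where
  "strands_below Cup = 0"
| "strands_below Cap = 2"
| "strands_below (Crossing c) = 2"
| "strands_below (Vertex m) = 2"

fun strands_above :: "piece \<Rightarrow> nat" where
  "strands_above Cup = 2"
| "strands_above Cap = 0"
| "strands_above (Crossing c) = 2"
| "strands_above (Vertex m) = 2"

text \<open>\<open>closes n D\<close>: the slices fit onto each other, beginning with \<open>n\<close> strands at
  the bottom and leaving none at the top.\<close>

fun closes :: "nat \<Rightarrow> slices \<Rightarrow> bool" where
  "closes n [] \<longleftrightarrow> n = 0"
| "closes n ((p, i) # D) \<longleftrightarrow>
     i + strands_below p \<le> n \<and> closes (n - strands_below p + strands_above p) D"

text \<open>Diagrams are non-empty, in accordance with \<open>a\<close> being indexed from 1.\<close>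

definition marked_graph_diagrams :: "slices set" where
  "marked_graph_diagrams = {D. D \<noteq> [] \<and> closes 0 D}"

definition link_diagrams :: "slices set" where
  "link_diagrams = {D \<in> marked_graph_diagrams. \<forall>m. Vertex m \<notin> fst ` set D}"

definition crossingless_diagrams :: "slices set" where
  "crossingless_diagrams = {D \<in> link_diagrams. \<forall>c. Crossing c \<notin> fst ` set D}"

text \<open>
  Number of link components, where strands go straight through crossings and vertices.
  The list \<open>l\<close> holds one label for each strand at the current height; two
  strands have equal labels iff they are connected in the part below.  Labels introduced by
  minima are counted by \<open>k\<close>.  A maximum closes a component if it joins two strands with
  equal labels, and otherwise the two labels become identified.
\<close>

fun components_from :: "nat \<Rightarrow> nat list \<Rightarrow> slices \<Rightarrow> nat" where
  "components_from k l [] = 0"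
| "components_from k l ((Cup, i) # D) = components_from (Suc k) (take i l @ [k, k] @ drop i l) D"
| "components_from k l ((Cap, i) # D) =
     (let x = l ! i; y = l ! (i + 1);
          l' = map (\<lambda>z. if z = y then x else z) (take i l @ drop (i + 2) l)
      in (if x = y then 1 else 0) + components_from k l' D)"
| "components_from k l ((_, i) # D) = components_from k (l[i := l ! (i + 1), i + 1 := l ! i]) D"

definition components :: "slices \<Rightarrow> nat" where
  "components D = components_from 0 [] D"


section \<open>Smoothings\<close>

text \<open>The two crossingless connections of the four ends at a vertex at position \<open>i\<close>:
  \<open>merge_bottom_top\<close> consists of two vertical strands, and \<open>merge_left_right\<close> of a
  maximum below a minimum.\<close>

definition merge_bottom_top :: "nat \<Rightarrow> slices" where
  "merge_bottom_top i = []"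

definition merge_left_right :: "nat \<Rightarrow> slices" where
  "merge_left_right i = [(Cap, i), (Cup, i)]"

text \<open>Rotating the overstrand of \<open>SlashOver\<close> counterclockwise sweeps out the top and bottom
  regions, that of \<open>BackslashOver\<close> the left and right ones.\<close>

fun crossing_zero :: "crossing \<Rightarrow> nat \<Rightarrow> slices" where
  "crossing_zero SlashOver i = merge_bottom_top i"
| "crossing_zero BackslashOver i = merge_left_right i"

fun crossing_infinity :: "crossing \<Rightarrow> nat \<Rightarrow> slices" where
  "crossing_infinity SlashOver i = merge_left_right i"
| "crossing_infinity BackslashOver i = merge_bottom_top i"

fun vertex_infinity :: "marker \<Rightarrow> nat \<Rightarrow> slices" where
  "vertex_infinity Horizontal i = merge_left_right i"
| "vertex_infinity Vertical i = merge_bottom_top i"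

fun vertex_zero :: "marker \<Rightarrow> nat \<Rightarrow> slices" where
  "vertex_zero Horizontal i = merge_bottom_top i"
| "vertex_zero Vertical i = merge_left_right i"

fun resolve_vertices :: "(marker \<Rightarrow> nat \<Rightarrow> slices) \<Rightarrow> slices \<Rightarrow> slices" where
  "resolve_vertices s [] = []"
| "resolve_vertices s ((Vertex m, i) # D) = s m i @ resolve_vertices s D"
| "resolve_vertices s (p # D) = p # resolve_vertices s D"

definition positive_resolution :: "slices \<Rightarrow> slices" where
  "positive_resolution = resolve_vertices vertex_infinity"

definition negative_resolution :: "slices \<Rightarrow> slices" where
  "negative_resolution = resolve_vertices vertex_zero"


section \<open>Planar isotopy and local moves\<close>

text \<open>\<open>local_change R\<close> replaces one side of an instance of \<open>R\<close> by the other side inside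
  a diagram.\<close>

definition local_change ::
  "(slices \<Rightarrow> slices \<Rightarrow> bool) \<Rightarrow> slices \<Rightarrow> slices \<Rightarrow> bool" where
  "local_change R D D' \<longleftrightarrow>
     D \<in> marked_graph_diagrams \<and> D' \<in> marked_graph_diagrams \<and>
     (\<exists>u v l r. (R l r \<or> R r l) \<and> D = u @ l @ v \<and> D' = u @ r @ v)"

text \<open>The effect of a quarter turn on a crossing or a marked vertex (either direction of
  rotation gives the same result).\<close>

inductive quarter_turn :: "piece \<Rightarrow> piece \<Rightarrow> bool" where
  "quarter_turn (Crossing SlashOver) (Crossing BackslashOver)"
| "quarter_turn (Crossing BackslashOver) (Crossing SlashOver)"
| "quarter_turn (Vertex Horizontal) (Vertex Vertical)"
| "quarter_turn (Vertex Vertical) (Vertex Horizontal)"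

text \<open>
  Two diagrams in general position are planar isotopic iff they are related by: exchanging the
  heights of two pieces lying side by side, creating or cancelling an adjacent minimum and maximum
  on a strand, and rotating a crossing or vertex around a minimum or maximum.  The rotation rules
  with the roles of left and right exchanged are included because \<open>local_change\<close> is symmetric.
\<close>

inductive isotopy_rule :: "slices \<Rightarrow> slices \<Rightarrow> bool" where
  exchange: "i \<le> j \<Longrightarrow>
    isotopy_rule [(p, i), (q, j + strands_above p)] [(q, j + strands_below p), (p, i)]"
| zigzag1: "isotopy_rule [(Cup, i), (Cap, i + 1)] []"
| zigzag2: "isotopy_rule [(Cup, i + 1), (Cap, i)] []"
| turn_Cup: "quarter_turn x y \<Longrightarrow> isotopy_rule [(Cup, i), (x, i + 1)] [(Cup, i + 1), (y, i)]"
| turn_Cap: "quarter_turn x y \<Longrightarrow> isotopy_rule [(x, i + 1), (Cap, i)] [(y, i), (Cap, i + 1)]"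

definition planar_isotopic :: "slices \<Rightarrow> slices \<Rightarrow> bool" where
  "planar_isotopic = (local_change isotopy_rule)\<^sup>*\<^sup>*"

datatype move = Gamma1 | Gamma2 | Gamma3 | Gamma4 | Gamma4' | Gamma5 | Gamma6 | Gamma6' | Gamma7 | Gamma8

definition double_crossing :: "crossing \<Rightarrow> nat \<Rightarrow> slices" where
  "double_crossing c i =
     [(Crossing c, i + 1), (Crossing c, i), (Crossing c, i + 2), (Crossing c, i + 1)]"

text \<open>
  Each move is given for one position of its disc; the rotated versions are obtained from it by
  planar isotopy.

  In \<open>Gamma3\<close>, the strands starting at \<open>i\<close>, \<open>i + 1\<close>, \<open>i + 2\<close> meet in the crossings
  \<open>x\<close> (first and second), \<open>y\<close> (first and third), \<open>z\<close> (second and third).  The premise says that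
  one strand is on top and one at the bottom, excluding the two cyclic patterns.

  \<open>double_crossing\<close> lets a pair of strands going from bottom left to top right cross a pair going
  from bottom right to top left; the former is entirely over the latter for \<open>SlashOver\<close>.  In
  \<open>Gamma8\<close> the former pair (\<open>Vertical\<close> marker, starting at \<open>i\<close>, \<open>i + 1\<close> and ending at
  \<open>i + 2\<close>, \<open>i + 3\<close>) is the horizontal pair of the usual picture turned by an eighth of a circle.
  The four rules correspond to the choices of the ends near which the markers are inserted.
\<close>

inductive move_rule :: "move \<Rightarrow> slices \<Rightarrow> slices \<Rightarrow> bool" where
  "move_rule Gamma1 [(Cup, i + 1), (Crossing c, i), (Cap, i + 1)] []"
| "c \<noteq> d \<Longrightarrow> move_rule Gamma2 [(Crossing c, i), (Crossing d, i)] []"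
| "(x = z \<Longrightarrow> y = x) \<Longrightarrow>
   move_rule Gamma3
     [(Crossing x, i), (Crossing y, i + 1), (Crossing z, i)]
     [(Crossing z, i + 1), (Crossing y, i), (Crossing x, i + 1)]"
| "move_rule Gamma4
     [(Crossing SlashOver, i), (Crossing SlashOver, i + 1), (Vertex m, i)]
     [(Vertex m, i + 1), (Crossing SlashOver, i), (Crossing SlashOver, i + 1)]"
| "move_rule Gamma4'
     [(Crossing BackslashOver, i), (Crossing BackslashOver, i + 1), (Vertex m, i)]
     [(Vertex m, i + 1), (Crossing BackslashOver, i), (Crossing BackslashOver, i + 1)]"
| "move_rule Gamma5 [(Crossing c, i), (Vertex m, i)] [(Vertex m, i), (Crossing c, i)]"
| "move_rule Gamma6 [(Vertex Horizontal, i), (Cap, i)] [(Cap, i)]"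
| "move_rule Gamma6' [(Vertex Vertical, i), (Cap, i)] [(Cap, i)]"
| "move_rule Gamma7
     [(Vertex Vertical, i), (Vertex Horizontal, i + 1)]
     [(Vertex Horizontal, i + 1), (Vertex Vertical, i)]"
| "move_rule Gamma8
     ([(Vertex Vertical, i), (Vertex Horizontal, i + 2)] @ double_crossing SlashOver i)
     ([(Vertex Vertical, i), (Vertex Horizontal, i + 2)] @ double_crossing BackslashOver i)"
| "move_rule Gamma8
     ([(Vertex Vertical, i)] @ double_crossing SlashOver i @ [(Vertex Horizontal, i)])
     ([(Vertex Vertical, i)] @ double_crossing BackslashOver i @ [(Vertex Horizontal, i)])"
| "move_rule Gamma8
     ([(Vertex Horizontal, i + 2)] @ double_crossing SlashOver i @ [(Vertex Vertical, i + 2)])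
     ([(Vertex Horizontal, i + 2)] @ double_crossing BackslashOver i @ [(Vertex Vertical, i + 2)])"
| "move_rule Gamma8
     (double_crossing SlashOver i @ [(Vertex Horizontal, i), (Vertex Vertical, i + 2)])
     (double_crossing BackslashOver i @ [(Vertex Horizontal, i), (Vertex Vertical, i + 2)])"

definition applied_once :: "move \<Rightarrow> slices \<Rightarrow> slices \<Rightarrow> bool" where
  "applied_once g = local_change (move_rule g)"

definition invariant_on :: "slices set \<Rightarrow> move set \<Rightarrow> (slices \<Rightarrow> 'b) \<Rightarrow> bool" where
  "invariant_on S M f \<longleftrightarrow>
     (\<forall>D\<in>S. \<forall>D'\<in>S. planar_isotopic D D' \<longrightarrow> f D = f D') \<and>
     (\<forall>g\<in>M. \<forall>D\<in>S. \<forall>D'\<in>S. applied_once g D D' \<longrightarrow> f D = f D')"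

text \<open>Equivalence of links in space is expressed by Reidemeister moves on diagrams.\<close>

definition link_equivalent :: "slices \<Rightarrow> slices \<Rightarrow> bool" where
  "link_equivalent =
     (\<lambda>D D'. D \<in> link_diagrams \<and> D' \<in> link_diagrams \<and>
       (planar_isotopic D D' \<or> (\<exists>g\<in>{Gamma1, Gamma2, Gamma3}. applied_once g D D')))\<^sup>*\<^sup>*"

definition trivial_link_diagram :: "slices \<Rightarrow> bool" where
  "trivial_link_diagram D \<longleftrightarrow>
     D \<in> link_diagrams \<and> (\<exists>T\<in>crossingless_diagrams. link_equivalent D T)"

definition admissible_diagrams :: "slices set" where
  "admissible_diagrams =
     {D \<in> marked_graph_diagrams.
        trivial_link_diagram (positive_resolution D) \<and> trivial_link_diagram (negative_resolution D)}"


section \<open>The functions \<open>P\<close> and \<open>P\<^sub>M\<close>\<close>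

text \<open>Functions on a set of diagrams are made extensional, i.e. \<open>undefined\<close> elsewhere, so that
  they are determined by their values on that set.\<close>

definition is_bracket :: "('a \<Rightarrow> 'a \<Rightarrow> 'a) \<Rightarrow> (nat \<Rightarrow> 'a) \<Rightarrow> (slices \<Rightarrow> 'a) \<Rightarrow> bool" where
  "is_bracket star a P \<longleftrightarrow>
     P \<in> extensional link_diagrams \<and>
     invariant_on link_diagrams {Gamma2, Gamma3} P \<and>
     (\<forall>T\<in>crossingless_diagrams. P T = a (components T)) \<and>
     (\<forall>u c i v. u @ [(Crossing c, i)] @ v \<in> link_diagrams \<longrightarrow>
        P (u @ [(Crossing c, i)] @ v) =
          star (P (u @ crossing_zero c i @ v)) (P (u @ crossing_infinity c i @ v)))"

definition bracket :: "('a \<Rightarrow> 'a \<Rightarrow> 'a) \<Rightarrow> (nat \<Rightarrow> 'a) \<Rightarrow> slices \<Rightarrow> 'a" where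
  "bracket star a = (THE P. is_bracket star a P)"

definition is_marked_bracket ::
  "('a \<Rightarrow> 'a \<Rightarrow> 'a) \<Rightarrow> (nat \<Rightarrow> 'a) \<Rightarrow> ('a \<Rightarrow> 'a \<Rightarrow> 'a) \<Rightarrow> (slices \<Rightarrow> 'a) \<Rightarrow> bool" where
  "is_marked_bracket star a bullet Q \<longleftrightarrow>
     Q \<in> extensional marked_graph_diagrams \<and>
     (\<forall>D\<in>link_diagrams. Q D = bracket star a D) \<and>
     (\<forall>u m i v. u @ [(Vertex m, i)] @ v \<in> marked_graph_diagrams \<longrightarrow>
        Q (u @ [(Vertex m, i)] @ v) =
          bullet (Q (u @ vertex_infinity m i @ v)) (Q (u @ vertex_zero m i @ v)))"

definition marked_bracket ::
  "('a \<Rightarrow> 'a \<Rightarrow> 'a) \<Rightarrow> (nat \<Rightarrow> 'a) \<Rightarrow> ('a \<Rightarrow> 'a \<Rightarrow> 'a) \<Rightarrow> slices \<Rightarrow> 'a" where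
  "marked_bracket star a bullet = (THE Q. is_marked_bracket star a bullet Q)"

end

theory Submission
  imports Defs "HOL-Number_Theory.Cong"
begin

text \<open>
  Because \<open>a\<close> has period 2, only the parity of the number of components of a crossingless diagram
  matters.  Orient its strands upwards and downwards alternately, from left to right; this is
  consistent, and the parity of the number of components is that of the total rotation number, to
  which a minimum or maximum at position \<open>i\<close> contributes half of \<open>(- 1) ^ i\<close>.  Hence the two
  smoothings of a crossing or vertex always give opposite parities, so that the state sum \<open>P\<^sub>M\<close>
  depends only on the number of crossings, the number of vertices, and the rotation number
  corrected by the number of crossings and vertices whose \<open>0\<close>- or \<open>\<infinity>\<close>-smoothing, respectively,
  is a maximum below a minimum.  The moves other than \<open>\<Gamma>\<^sub>1\<close>, \<open>\<Gamma>\<^sub>6\<close>, \<open>\<Gamma>\<^sub>6'\<close> visibly preserve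
  these data, except for \<open>\<Gamma>\<^sub>2\<close>, which is the bracket identity for \<open>a 1\<close> and \<open>a 2\<close>.
\<close>

section \<open>Parity of the number of components\<close>

text \<open>Contributions to twice the rotation number, to be read modulo 4. A crossing weighs as
  much as its \<open>0\<close>-smoothing and a vertex as much as its
  \<open>\<infinity>\<close>-smoothing: two vertical strands give 0, and a maximum below a minimum
  gives \<open>2 * (- 1) ^ i\<close>, which is 2 modulo 4 for every \<open>i\<close>.\<close>

fun weight :: "piece \<times> nat \<Rightarrow> int" where
  "weight (Cup, i) = (- 1) ^ i"
| "weight (Cap, i) = (- 1) ^ i"
| "weight (Crossing SlashOver, i) = 0"
| "weight (Crossing BackslashOver, i) = 2"
| "weight (Vertex Vertical, i) = 0"
| "weight (Vertex Horizontal, i) = 2"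

lemma weight_Crossing: "weight (Crossing c, i) = (if c = SlashOver then 0 else 2)"
  by (cases c) auto

lemma weight_Vertex: "weight (Vertex m, i) = (if m = Vertical then 0 else 2)"
  by (cases m) auto

definition turning :: "slices \<Rightarrow> int" where
  "turning D = (\<Sum>s\<leftarrow>D. weight s)"

lemma turning_simps [simp]:
  "turning [] = 0"
  "turning (s # D) = weight s + turning D"
  "turning (D @ E) = turning D + turning E"
  by (simp_all add: turning_def)

text \<open>\<open>noncrossing l g\<close>: equal labels in \<open>l\<close> are the two ends of an arc of a planar matching,
  and the arcs can be drawn from minima of total weight \<open>g\<close> modulo 4.\<close>

inductive noncrossing :: "nat list \<Rightarrow> int \<Rightarrow> bool" where
  Nil: "[g = 0] (mod 4) \<Longrightarrow> noncrossing [] g"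
| Arc: "noncrossing (xs @ ys) g \<Longrightarrow> z \<notin> set xs \<union> set ys \<Longrightarrow>
    [h = g + (- 1) ^ length xs] (mod 4) \<Longrightarrow> noncrossing (xs @ [z, z] @ ys) h"

lemma noncrossing_cong: "noncrossing l g \<Longrightarrow> [h = g] (mod 4) \<Longrightarrow> noncrossing l h"
  by (erule noncrossing.cases) (metis noncrossing.intros cong_trans)+

lemma noncrossing_Nil: "noncrossing [] g \<Longrightarrow> [g = 0] (mod 4)"
  by (auto elim: noncrossing.cases)

lemma noncrossing_two: "noncrossing [x, y] g \<Longrightarrow> x = y"
  by (erule noncrossing.cases) (auto simp: Cons_eq_append_conv)

lemma noncrossing_map:
  "noncrossing l g \<Longrightarrow> inj_on f (set l) \<Longrightarrow> noncrossing (map f l) g"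
proof (induction rule: noncrossing.induct)
  case (Nil g)
  then show ?case by (simp add: noncrossing.Nil)
next
  case (Arc xs ys g z h)
  have "noncrossing (map f xs @ map f ys) g"
    using Arc.IH Arc.prems by (simp add: inj_on_Un)
  moreover have "f z \<notin> set (map f xs) \<union> set (map f ys)"
    using Arc.prems Arc.hyps(2) by (auto simp: inj_on_def)
  ultimately show ?case
    using noncrossing.Arc[of "map f xs" "map f ys" g "f z" h] Arc.hyps(3) by simp
qed

lemma minus_one_power_cong: "[(- 1) ^ n + (- 1) ^ n = (2::int)] (mod 4)"
  by (cases "even n") (auto simp: cong_def)

text \<open>The arc inserted last either lies to one side of the maximum, shares one end with it, or
  is closed off by it. In the first case the two operations commute, since positions shift by 0 or
  2; in the second they form a zigzag, whose weights cancel; in the third their equal weights add up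
  to 2 modulo 4. The 2 is subtracted whenever a component closes, so that only open arcs are
  counted.\<close>

lemma noncrossing_cap:
  assumes "noncrossing l g" and "l = xs @ [x, y] @ ys"
  shows "noncrossing (map (\<lambda>z. if z = y then x else z) (xs @ ys))
    (g + (- 1) ^ length xs - (if x = y then 2 else 0))"
  using assms
proof (induction arbitrary: xs ys rule: noncrossing.induct)
  case (Nil g)
  then show ?case by simp
next
  case (Arc us vs g z h)
  let ?m = "map (\<lambda>z. if z = y then x else z)"
  let ?d = "if x = y then 2 else 0 :: int"
  consider
      (left) ws where "us = xs @ [x, y] @ ws" "ys = ws @ [z, z] @ vs"
    | (last) "us = xs @ [x]" "y = z" "ys = z # vs"
    | (arc) "us = xs" "x = z" "y = z" "ys = vs"
    | (first) "xs = us @ [z]" "x = z" "vs = y # ys"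
    | (right) ws where "xs = us @ [z, z] @ ws" "vs = ws @ [x, y] @ ys"
    using Arc.prems by (auto simp: append_eq_append_conv2 append_eq_Cons_conv Cons_eq_append_conv)
  then show ?case
  proof cases
    case left
    have "noncrossing (?m (xs @ ws @ vs)) (g + (- 1) ^ length xs - ?d)"
      using Arc.IH[of xs "ws @ vs"] left by simp
    then have "noncrossing (?m (xs @ ws) @ [z, z] @ ?m vs) (h + (- 1) ^ length xs - ?d)"
      using Arc.hyps left
      by (intro noncrossing.Arc[where g = "g + (- 1) ^ length xs - ?d"])
        (auto simp: cong_iff_dvd_diff algebra_simps)
    then show ?thesis
      using Arc.hyps(2) left by auto
  next
    case last
    have "?m (xs @ ys) = us @ vs"
      using last Arc.hyps(2) by (auto intro!: map_idI)
    moreover have "[h + (- 1) ^ length xs - ?d = g] (mod 4)"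
      using last Arc.hyps(2,3) by (auto simp: cong_iff_dvd_diff algebra_simps)
    ultimately show ?thesis
      using Arc.hyps(1) noncrossing_cong by metis
  next
    case arc
    have "?m (xs @ ys) = us @ vs"
      using arc by (auto intro!: map_idI)
    moreover have "[h + (- 1) ^ length xs - ?d = g] (mod 4)"
    proof -
      have "[h + (- 1) ^ length xs - 2 = g + (- 1) ^ length xs + (- 1) ^ length xs - 2] (mod 4)"
        using arc Arc.hyps(3) by (simp add: cong_iff_dvd_diff algebra_simps)
      also have "[g + (- 1) ^ length xs + (- 1) ^ length xs - 2 = g] (mod 4)"
        using minus_one_power_cong[of "length xs"] by (simp add: cong_iff_dvd_diff algebra_simps)
      finally show ?thesis using arc by simp
    qed
    ultimately show ?thesis
      using Arc.hyps(1) noncrossing_cong by metis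
  next
    case first
    have "?m (xs @ ys) = ?m (us @ vs)"
      using first by simp
    \<comment> \<open>Here \<open>x\<close> is the label \<open>z\<close>, fresh for
      \<open>us @ vs\<close>, so identifying \<open>y\<close> with it is an injective
      renaming.\<close>
    moreover have "noncrossing (?m (us @ vs)) g"
      using Arc.hyps first by (intro noncrossing_map) (auto simp: inj_on_def)
    moreover have "[h + (- 1) ^ length xs - ?d = g] (mod 4)"
      using first Arc.hyps(2,3) by (auto simp: cong_iff_dvd_diff algebra_simps)
    ultimately show ?thesis
      using noncrossing_cong by metis
  next
    case right
    have "noncrossing (?m (us @ ws @ ys)) (g + (- 1) ^ length (us @ ws) - ?d)"
      using Arc.IH[of "us @ ws" ys] right by simp
    then have "noncrossing (?m us @ [z, z] @ ?m (ws @ ys)) (h + (- 1) ^ length xs - ?d)"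
      using Arc.hyps right
      by (intro noncrossing.Arc[where g = "g + (- 1) ^ length (us @ ws) - ?d"])
        (auto simp: cong_iff_dvd_diff algebra_simps)
    then show ?thesis
      using Arc.hyps(2) right by auto
  qed
qed

section \<open>Rotation count of crossingless diagrams\<close>

definition crossingless :: "slices \<Rightarrow> bool" where
  "crossingless D \<longleftrightarrow> fst ` set D \<subseteq> {Cup, Cap}"

lemma split_two_at: "i + 2 \<le> length l \<Longrightarrow> l = take i l @ [l ! i, l ! (i + 1)] @ drop (i + 2) l"
  by (simp add: Cons_nth_drop_Suc)

text \<open>Scanning upwards, \<open>g\<close> is the weight of the open arcs below, and every
  component that closes uses up 2 modulo 4. The bound on the labels keeps \<open>k\<close> fresh for
  the next minimum. Positivity is carried along because \<open>a\<close> is indexed from 1.\<close>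

lemma components_from_turning:
  assumes "crossingless D" and "closes (length l) D"
    and "noncrossing l g" and "\<forall>z\<in>set l. z < k"
  shows "[g + turning D = 2 * int (components_from k l D)] (mod 4) \<and>
    (l \<noteq> [] \<longrightarrow> components_from k l D > 0)"
  using assms
proof (induction k l D arbitrary: g rule: components_from.induct)
  case (1 k l)
  then show ?case by (simp add: noncrossing_Nil)
next
  case (2 k l i D)
  have "noncrossing (take i l @ [k, k] @ drop i l) (g + (- 1) ^ i)"
    using "2.prems" by (intro noncrossing.Arc[where g = g]) (auto dest: in_set_takeD in_set_dropD)
  from "2.IH"[OF _ _ this] "2.prems" show ?case
    by (auto simp: crossingless_def algebra_simps less_Suc_eq dest: in_set_takeD in_set_dropD)
next
  case (3 k l i D)
  define x y where "x = l ! i" and "y = l ! (i + 1)"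
  define l' where "l' = map (\<lambda>z. if z = y then x else z) (take i l @ drop (i + 2) l)"
  define d :: int where "d = (if x = y then 2 else 0)"
  have i: "i + 2 \<le> length l" and cl: "closes (length l') D" and D: "crossingless D"
    using "3.prems" by (auto simp: l'_def crossingless_def)
  have l: "l = take i l @ [x, y] @ drop (i + 2) l"
    using split_two_at[OF i] by (simp add: x_def y_def)
  have "noncrossing l' (g + (- 1) ^ i - d)"
    using noncrossing_cap[OF "3.prems"(3) l] i by (simp add: l'_def d_def)
  moreover have "\<forall>z\<in>set l'. z < k"
    using "3.prems"(4) i by (auto simp: l'_def x_def dest: in_set_takeD in_set_dropD)
  ultimately have IH: "[g + (- 1) ^ i - d + turning D = 2 * int (components_from k l' D)] (mod 4)"
      "l' \<noteq> [] \<Longrightarrow> components_from k l' D > 0"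
    using "3.IH"[OF x_def y_def l'_def D cl] by blast+
  have eq: "components_from k l ((Cap, i) # D) = (if x = y then 1 else 0) + components_from k l' D"
    unfolding components_from.simps Let_def x_def y_def l'_def ..
  \<comment> \<open>If the maximum leaves no strand, it meets the two ends of a single arc and
    closes a component.\<close>
  have "x = y" if "l' = []"
  proof -
    have "take i l = []" "drop (i + 2) l = []"
      using that by (simp_all only: l'_def map_is_Nil_conv append_is_Nil_conv)
    with l have "l = [x, y]" by simp
    then show ?thesis using "3.prems"(3) noncrossing_two by metis
  qed
  then have "components_from k l ((Cap, i) # D) > 0"
    unfolding eq using IH(2) by auto
  moreover have
    "[g + turning ((Cap, i) # D) = 2 * int (components_from k l ((Cap, i) # D))] (mod 4)"
    unfolding eq using cong_add[OF IH(1) cong_refl[of d]]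
    by (simp add: d_def ac_simps split: if_splits)
  ultimately show ?case by blast
qed (auto simp: crossingless_def)

section \<open>State sums over a sequence of period 2\<close>

definition crossings :: "slices \<Rightarrow> nat" where
  "crossings D = (\<Sum>s\<leftarrow>D. case fst s of Crossing c \<Rightarrow> 1 | _ \<Rightarrow> 0)"

definition vertices :: "slices \<Rightarrow> nat" where
  "vertices D = (\<Sum>s\<leftarrow>D. case fst s of Vertex m \<Rightarrow> 1 | _ \<Rightarrow> 0)"

lemma crossings_simps [simp]:
  "crossings [] = 0"
  "crossings ((p, i) # D) = (case p of Crossing c \<Rightarrow> 1 | _ \<Rightarrow> 0) + crossings D"
  "crossings (D @ E) = crossings D + crossings E"
  by (simp_all add: crossings_def)

lemma vertices_simps [simp]:
  "vertices [] = 0"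
  "vertices ((p, i) # D) = (case p of Vertex m \<Rightarrow> 1 | _ \<Rightarrow> 0) + vertices D"
  "vertices (D @ E) = vertices D + vertices E"
  by (simp_all add: vertices_def)

lemma crossings_eq_0_iff: "crossings D = 0 \<longleftrightarrow> (\<forall>c. Crossing c \<notin> fst ` set D)"
  by (induction D) (auto split: piece.splits)

lemma vertices_eq_0_iff: "vertices D = 0 \<longleftrightarrow> (\<forall>m. Vertex m \<notin> fst ` set D)"
  by (induction D) (auto split: piece.splits)

lemma crossingless_iff: "crossingless D \<longleftrightarrow> crossings D = 0 \<and> vertices D = 0"
proof -
  have "p \<in> {Cup, Cap} \<longleftrightarrow> (\<forall>c. p \<noteq> Crossing c) \<and> (\<forall>m. p \<noteq> Vertex m)" for p
    by (cases p) auto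
  then show ?thesis
    unfolding crossingless_def crossings_eq_0_iff vertices_eq_0_iff subset_iff by metis
qed

lemma link_diagrams_iff: "D \<in> link_diagrams \<longleftrightarrow> D \<in> marked_graph_diagrams \<and> vertices D = 0"
  by (auto simp: link_diagrams_def vertices_eq_0_iff)

lemma crossingless_diagrams_iff:
  "D \<in> crossingless_diagrams \<longleftrightarrow> D \<in> link_diagrams \<and> crossings D = 0"
  by (auto simp: crossingless_diagrams_def crossings_eq_0_iff)

lemma split_at_crossing:
  assumes "crossings D \<noteq> 0"
  obtains u c i v where "D = u @ [(Crossing c, i)] @ v"
  using assms by (auto simp: crossings_eq_0_iff dest!: split_list)

lemma split_at_vertex:
  assumes "vertices D \<noteq> 0"
  obtains u m i v where "D = u @ [(Vertex m, i)] @ v"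
  using assms by (auto simp: vertices_eq_0_iff dest!: split_list)

lemma components_turning:
  assumes "D \<in> crossingless_diagrams"
  shows "odd (components D) \<longleftrightarrow> odd (turning D div 2)" and "components D > 0"
proof -
  have D: "D \<noteq> []" "closes 0 D" "crossingless D"
    using assms
    by (auto simp: crossingless_diagrams_iff link_diagrams_iff marked_graph_diagrams_def
      crossingless_iff)
  then have "[0 + turning D = 2 * int (components D)] (mod 4)"
    using components_from_turning[of D "[]" 0 0] by (simp add: components_def noncrossing.Nil)
  then show "odd (components D) \<longleftrightarrow> odd (turning D div 2)"
    unfolding cong_def by presburger
  \<comment> \<open>Only a minimum at position 0 fits onto zero strands; after it the strand list is
    non-empty, as positivity requires.\<close>
  from D obtain i E where E: "D = (Cup, i) # E" "i = 0"
    by (cases D) (auto simp: crossingless_def)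
  have "noncrossing ([] @ [0, 0] @ []) 1"
    by (rule noncrossing.Arc[where g = 0]) (auto intro: noncrossing.Nil)
  then show "components D > 0"
    using components_from_turning[of E "[0, 0]" 1 1] D E
    by (simp add: components_def crossingless_def)
qed

section \<open>Smoothings of diagrams are diagrams\<close>

lemma closes_replace:
  assumes "\<And>n. closes n (x # v) \<Longrightarrow> closes n (r @ v)" and "closes n (u @ x # v)"
  shows "closes n (u @ r @ v)"
  using assms(2) by (induction n u rule: closes.induct) (auto intro: assms(1))

lemma marked_graph_diagrams_replace:
  assumes "u @ [(p, i)] @ v \<in> marked_graph_diagrams" and "strands_below p = 2" "strands_above p = 2"
    and "r \<in> {merge_bottom_top i, merge_left_right i}"
  shows "u @ r @ v \<in> marked_graph_diagrams"
proof -
  have "closes n (r @ v)" if c: "closes n ((p, i) # v)" for n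
  proof -
    obtain k where "n = i + 2 + k"
      using c assms(2) le_Suc_ex[of "i + 2" n] by auto
    then show ?thesis
      using c assms by (auto simp: merge_bottom_top_def merge_left_right_def)
  qed
  then have "closes 0 (u @ r @ v)"
    using assms(1) by (intro closes_replace[of "(p, i)"]) (auto simp: marked_graph_diagrams_def)
  \<comment> \<open>The smoothing into vertical strands is the empty list, so non-emptiness must
    come from \<open>u\<close>: a slice with two strands below cannot be the first.\<close>
  moreover have "u \<noteq> []"
    using assms by (auto simp: marked_graph_diagrams_def)
  ultimately show ?thesis
    by (simp add: marked_graph_diagrams_def)
qed

section \<open>Closed form of the state sum\<close>

text \<open>If \<open>h\<close> gives the value of the smoothed diagrams as a function of parity,
  \<open>skein f h\<close> gives the value before smoothing: the two smoothings have parities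
  \<open>b\<close> and \<open>\<not> b\<close>.\<close>

definition skein :: "('a \<Rightarrow> 'a \<Rightarrow> 'a) \<Rightarrow> (bool \<Rightarrow> 'a) \<Rightarrow> bool \<Rightarrow> 'a" where
  "skein f h b = f (h b) (h (\<not> b))"

lemma skein_Not: "(skein f ^^ n) (\<lambda>b. h (\<not> b)) = (\<lambda>b. (skein f ^^ n) h (\<not> b))"
  by (induction n) (auto simp: skein_def)

locale periodic_bracket_magma = marked_kauffman_bracket_magma star a bullet
  for star :: "'a \<Rightarrow> 'a \<Rightarrow> 'a" and a :: "nat \<Rightarrow> 'a" and bullet :: "'a \<Rightarrow> 'a \<Rightarrow> 'a" +
  assumes periodic: "n \<ge> 1 \<Longrightarrow> a n = a (n + 2)"
begin

definition loop_value :: "bool \<Rightarrow> 'a" where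
  "loop_value b = (if b then a 1 else a 2)"

text \<open>Vertices are spliced before crossings are smoothed, so the \<open>bullet\<close> layers
  lie outside the \<open>star\<close> layers. The Boolean argument is the parity of the corrected
  rotation number.\<close>

definition state_value :: "nat \<Rightarrow> nat \<Rightarrow> int \<Rightarrow> 'a" where
  "state_value n m t = (skein bullet ^^ m) ((skein star ^^ n) loop_value) (odd (t div 2))"

definition diagram_value :: "slices \<Rightarrow> 'a" where
  "diagram_value D = state_value (crossings D) (vertices D) (turning D)"

lemma a_eq_loop_value: "n > 0 \<Longrightarrow> a n = loop_value (odd n)"
proof (induction n rule: less_induct)
  case (less n)
  show ?case
  proof (cases "n \<le> 2")
    case True
    then have "n = 1 \<or> n = 2" using less.prems by auto
    then show ?thesis by (auto simp: loop_value_def)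
  next
    case False
    then obtain k where "n = k + 2" "k > 0"
      by (metis add.commute less_imp_add_positive not_le)
    then show ?thesis using periodic[of k] less.IH[of k] by simp
  qed
qed

text \<open>At \<open>True\<close> this is \<open>bracket2\<close> for \<open>n = 1\<close>; at
  \<open>False\<close> it is \<open>bracket1\<close> for \<open>n = 1\<close> with
  \<open>a 3 = a 1\<close>.\<close>

lemma skein_skein_loop_value: "skein star (skein star loop_value) = (\<lambda>b. loop_value (\<not> b))"
  using bracket1[of 1] bracket2[of 1] periodic[of 1]
  by (auto simp: skein_def loop_value_def numeral_2_eq_2 numeral_3_eq_3)

lemma state_value_cong: "[s = t] (mod 4) \<Longrightarrow> state_value n m s = state_value n m t"
proof -
  assume "[s = t] (mod 4)"
  then have "odd (s div 2) \<longleftrightarrow> odd (t div 2)"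
    unfolding cong_def by presburger
  then show ?thesis by (simp add: state_value_def)
qed

lemma odd_div_2_add_2: "odd ((t + 2) div 2) \<longleftrightarrow> even ((t :: int) div 2)"
  by presburger

lemma state_value_Suc_vertex:
  "state_value n (Suc m) t = bullet (state_value n m t) (state_value n m (t + 2))"
  by (simp add: state_value_def skein_def odd_div_2_add_2)

lemma state_value_Suc_crossing:
  "state_value (Suc n) 0 t = star (state_value n 0 t) (state_value n 0 (t + 2))"
  by (simp add: state_value_def skein_def odd_div_2_add_2)

text \<open>Algebraic form of \<open>Gamma2\<close>: the two innermost \<open>star\<close> layers
  negate the parity, the negation passes out through all other layers, and the shift of
  \<open>t\<close> by 2 undoes it.\<close>

lemma state_value_add_2_crossings: "state_value (n + 2) m (t + 2) = state_value n m t"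
proof -
  have "(skein star ^^ (n + 2)) loop_value = (\<lambda>b. (skein star ^^ n) loop_value (\<not> b))"
    unfolding funpow_add comp_apply
    by (simp add: numeral_2_eq_2 skein_skein_loop_value skein_Not)
  then show ?thesis
    by (simp add: state_value_def skein_Not odd_div_2_add_2)
qed

section \<open>Invariance of the closed form under isotopy and moves\<close>

lemma diagram_value_cong:
  assumes "crossings l = crossings r" "vertices l = vertices r" "[turning l = turning r] (mod 4)"
  shows "diagram_value (u @ l @ v) = diagram_value (u @ r @ v)"
  unfolding diagram_value_def using assms
  by (auto intro!: state_value_cong cong_add)

text \<open>Exchanges shift positions by even numbers, and zigzags have opposite weights. A quarter
  turn changes the weight of the piece by 2, while the minimum or maximum moves by one position and
  changes sign, again a change by 2.\<close>

lemma diagram_value_isotopy_rule: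
  assumes "isotopy_rule l r"
  shows "diagram_value (u @ l @ v) = diagram_value (u @ r @ v)"
proof -
  have s: "even (strands_above p)" "even (strands_below p)" for p
    by (cases p; simp)+
  have "weight (q, j + strands_above p) = weight (q, j + strands_below p)" for p q j
    using s[of p] by (cases "(q, j)" rule: weight.cases) (auto simp: power_add)
  moreover have "4 dvd 2 * (- 1) ^ i - (2::int)" "4 dvd 2 + 2 * (- 1 :: int) ^ i" for i :: nat
    by (cases "even i"; simp)+
  ultimately show ?thesis
    using assms
    by (intro diagram_value_cong)
      (auto elim!: isotopy_rule.cases quarter_turn.cases simp: cong_iff_dvd_diff algebra_simps
        split: piece.splits)
qed

lemma diagram_value_local_change:
  assumes "\<And>u v l r. R l r \<Longrightarrow> diagram_value (u @ l @ v) = diagram_value (u @ r @ v)"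
    and "local_change R D E"
  shows "diagram_value D = diagram_value E"
  using assms unfolding local_change_def by metis

lemma diagram_value_planar_isotopic:
  assumes "planar_isotopic D E"
  shows "diagram_value D = diagram_value E"
  using assms unfolding planar_isotopic_def
  by (induction rule: rtranclp_induct)
    (use diagram_value_local_change[OF diagram_value_isotopy_rule] in \<open>metis+\<close>)

text \<open>For \<open>Gamma2\<close>, opposite crossings have weights 0 and 2.
  \<open>Gamma8\<close> changes four crossings, hence the turning by 8. All other moves considered
  merely permute crossings and vertices, whose weights do not depend on position.\<close>

lemma diagram_value_move_rule:
  assumes "move_rule g l r" and "g \<notin> {Gamma1, Gamma6, Gamma6'}"
  shows "diagram_value (u @ l @ v) = diagram_value (u @ r @ v)"
proof (cases "g = Gamma2")
  case True
  then obtain c d i where "c \<noteq> d" "l = [(Crossing c, i), (Crossing d, i)]" "r = []"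
    using assms(1) by (auto elim: move_rule.cases)
  then have "crossings l = 2" "vertices l = 0" "turning l = 2"
    by (cases c; cases d; simp)+
  then show ?thesis
    using \<open>r = []\<close> state_value_add_2_crossings[of "crossings u + crossings v" _ "turning u + turning v"]
    by (simp add: diagram_value_def algebra_simps)
next
  case False
  have "crossings l = crossings r \<and> vertices l = vertices r \<and> [turning l = turning r] (mod 4)"
    using assms(1)
    by (cases rule: move_rule.cases)
      (use assms(2) False in \<open>auto simp: double_crossing_def weight_Crossing weight_Vertex cong_def\<close>)
  then show ?thesis by (intro diagram_value_cong) auto
qed

lemma diagram_value_applied_once:
  assumes "applied_once g D E" and "g \<notin> {Gamma1, Gamma6, Gamma6'}"
  shows "diagram_value D = diagram_value E"
  using diagram_value_local_change[OF diagram_value_move_rule[OF _ assms(2)]] assms(1)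
  by (simp add: applied_once_def)

section \<open>Identification of \<open>bracket\<close> and \<open>marked_bracket\<close> with the
  closed form\<close>

lemma diagram_value_crossingless:
  assumes "T \<in> crossingless_diagrams"
  shows "diagram_value T = a (components T)"
  using assms components_turning[OF assms]
  by (simp add: diagram_value_def state_value_def a_eq_loop_value crossingless_diagrams_iff
    link_diagrams_iff)

lemma diagram_value_crossing:
  assumes "u @ [(Crossing c, i)] @ v \<in> link_diagrams"
  shows "diagram_value (u @ [(Crossing c, i)] @ v) =
    star (diagram_value (u @ crossing_zero c i @ v)) (diagram_value (u @ crossing_infinity c i @ v))"
proof -
  let ?n = "crossings u + crossings v" and ?t = "turning u + turning v"
  have "state_value ?n 0 (?t + 2 + 2) = state_value ?n 0 ?t"
    by (rule state_value_cong) (simp add: cong_iff_dvd_diff)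
  \<comment> \<open>For \<open>BackslashOver\<close> the recursion starts at \<open>?t + 2\<close>,
    and its second argument returns to \<open>?t\<close> modulo 4, the turning of the vertical
    smoothing.\<close>
  moreover have "state_value ?n 0 (turning u + ((- 1) ^ i + ((- 1) ^ i + turning v))) =
      state_value ?n 0 (?t + 2)"
    using minus_one_power_cong[of i]
    by (intro state_value_cong) (simp add: cong_iff_dvd_diff algebra_simps)
  ultimately show ?thesis
    using assms state_value_Suc_crossing[of ?n ?t] state_value_Suc_crossing[of ?n "?t + 2"]
    by (cases c) (simp_all add: diagram_value_def merge_left_right_def merge_bottom_top_def
      link_diagrams_iff algebra_simps)
qed

lemma diagram_value_vertex:
  "diagram_value (u @ [(Vertex m, i)] @ v) =
    bullet (diagram_value (u @ vertex_infinity m i @ v)) (diagram_value (u @ vertex_zero m i @ v))"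
proof -
  let ?n = "crossings u + crossings v" and ?k = "vertices u + vertices v"
  let ?t = "turning u + turning v"
  have "state_value ?n ?k (?t + 2 + 2) = state_value ?n ?k ?t"
    by (rule state_value_cong) (simp add: cong_iff_dvd_diff)
  moreover have "state_value ?n ?k (turning u + ((- 1) ^ i + ((- 1) ^ i + turning v))) =
      state_value ?n ?k (?t + 2)"
    using minus_one_power_cong[of i]
    by (intro state_value_cong) (simp add: cong_iff_dvd_diff algebra_simps)
  ultimately show ?thesis
    using state_value_Suc_vertex[of ?n ?k ?t] state_value_Suc_vertex[of ?n ?k "?t + 2"]
    by (cases m) (simp_all add: diagram_value_def merge_left_right_def merge_bottom_top_def
      algebra_simps)
qed

text \<open>Since \<open>bracket\<close> is a definite description, two facts are needed: induction
  on the number of crossings forces every solution to agree with \<open>diagram_value\<close> on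
  link diagrams, and the restriction of \<open>diagram_value\<close> is itself a solution.\<close>

lemma bracket_eq_diagram_value:
  assumes "D \<in> link_diagrams"
  shows "bracket star a D = diagram_value D"
proof -
  have sm: "u @ crossing_zero c i @ v \<in> link_diagrams" "u @ crossing_infinity c i @ v \<in> link_diagrams"
    if "u @ [(Crossing c, i)] @ v \<in> link_diagrams" for u c i v
  proof -
    have "r \<in> {merge_bottom_top i, merge_left_right i} \<Longrightarrow> u @ r @ v \<in> link_diagrams" for r
      using that marked_graph_diagrams_replace[of u "Crossing c" i v r]
      by (auto simp: link_diagrams_iff merge_left_right_def merge_bottom_top_def)
    then show "u @ crossing_zero c i @ v \<in> link_diagrams"
        "u @ crossing_infinity c i @ v \<in> link_diagrams"
      by (cases c; simp)+
  qed
  have uniq: "P D = diagram_value D" if P: "is_bracket star a P" and "D \<in> link_diagrams" for P D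
    using that(2)
  proof (induction "crossings D" arbitrary: D rule: less_induct)
    case less
    show ?case
    proof (cases "crossings D = 0")
      case True
      then show ?thesis
        using P less.prems diagram_value_crossingless
        by (simp add: is_bracket_def crossingless_diagrams_iff)
    next
      case False
      then obtain u c i v where D: "D = u @ [(Crossing c, i)] @ v"
        by (rule split_at_crossing)
      have less_crossings: "crossings (u @ crossing_zero c i @ v) < crossings D"
          "crossings (u @ crossing_infinity c i @ v) < crossings D"
        by (cases c; simp add: D merge_left_right_def merge_bottom_top_def)+
      have "P D = star (P (u @ crossing_zero c i @ v)) (P (u @ crossing_infinity c i @ v))"
        using P less.prems unfolding D is_bracket_def by blast
      then show ?thesis
        using less less_crossings sm diagram_value_crossing by (simp add: D)
    qed
  qed
  let ?P = "restrict diagram_value link_diagrams"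
  have "is_bracket star a ?P"
    unfolding is_bracket_def
    using diagram_value_crossing sm diagram_value_crossingless
    by (auto simp: invariant_on_def crossingless_diagrams_iff
      intro: diagram_value_planar_isotopic diagram_value_applied_once)
  moreover have "P = ?P" if "is_bracket star a P" for P
    using that uniq by (intro extensionalityI[of _ link_diagrams]) (auto simp: is_bracket_def)
  ultimately have "bracket star a = ?P"
    unfolding bracket_def by (rule the_equality)
  then show ?thesis
    using assms by simp
qed

text \<open>Existence and uniqueness again, now by induction on the number of vertices, with
  \<open>bracket_eq_diagram_value\<close> as the base case.\<close>

lemma marked_bracket_eq_diagram_value:
  assumes "D \<in> marked_graph_diagrams"
  shows "marked_bracket star a bullet D = diagram_value D"
proof -
  have sm: "u @ vertex_infinity m i @ v \<in> marked_graph_diagrams"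
      "u @ vertex_zero m i @ v \<in> marked_graph_diagrams"
    if "u @ [(Vertex m, i)] @ v \<in> marked_graph_diagrams" for u m i v
    using that marked_graph_diagrams_replace[of u "Vertex m" i v]
    by (cases m; simp)+
  have uniq: "Q D = diagram_value D"
    if Q: "is_marked_bracket star a bullet Q" and "D \<in> marked_graph_diagrams" for Q D
    using that(2)
  proof (induction "vertices D" arbitrary: D rule: less_induct)
    case less
    show ?case
    proof (cases "vertices D = 0")
      case True
      then show ?thesis
        using Q less.prems
        by (simp add: is_marked_bracket_def link_diagrams_iff bracket_eq_diagram_value)
    next
      case False
      then obtain u m i v where D: "D = u @ [(Vertex m, i)] @ v"
        by (rule split_at_vertex)
      have less_vertices: "vertices (u @ vertex_infinity m i @ v) < vertices D"
          "vertices (u @ vertex_zero m i @ v) < vertices D"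
        by (cases m; simp add: D merge_left_right_def merge_bottom_top_def)+
      have "Q D = bullet (Q (u @ vertex_infinity m i @ v)) (Q (u @ vertex_zero m i @ v))"
        using Q less.prems unfolding D is_marked_bracket_def by blast
      then show ?thesis
        using less less_vertices sm diagram_value_vertex by (simp add: D)
    qed
  qed
  let ?Q = "restrict diagram_value marked_graph_diagrams"
  have "is_marked_bracket star a bullet ?Q"
    unfolding is_marked_bracket_def
    using diagram_value_vertex sm bracket_eq_diagram_value by (auto simp: link_diagrams_iff)
  moreover have "Q = ?Q" if "is_marked_bracket star a bullet Q" for Q
    using that uniq
    by (intro extensionalityI[of _ marked_graph_diagrams]) (auto simp: is_marked_bracket_def)
  ultimately have "marked_bracket star a bullet = ?Q"
    unfolding marked_bracket_def by (rule the_equality)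
  then show ?thesis
    using assms by simp
qed

lemma marked_bracket_invariant:
  "invariant_on marked_graph_diagrams (UNIV - {Gamma1, Gamma6, Gamma6'})
    (marked_bracket star a bullet)"
  by (auto simp: invariant_on_def marked_bracket_eq_diagram_value
    intro: diagram_value_planar_isotopic diagram_value_applied_once)

end

theorem theorem4p4:
  fixes star bullet :: "'a \<Rightarrow> 'a \<Rightarrow> 'a"
    and a :: "nat \<Rightarrow> 'a"
    and \<phi> :: "slices \<Rightarrow> 'a \<Rightarrow> 'a"
  assumes "marked_kauffman_bracket_magma star a bullet"
    and "\<And>n. n \<ge> 1 \<Longrightarrow> a n = a (n + 2)"
    and "\<And>x y z w. bullet (star x y) (star z w) = star (bullet x z) (bullet y w)"
    and "invariant_on admissible_diagrams (UNIV - {Gamma1, Gamma6, Gamma6'}) \<phi>"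
    and "\<And>g D D'. \<lbrakk>g \<in> {Gamma6, Gamma6'}; D \<in> admissible_diagrams; D' \<in> admissible_diagrams;
           applied_once g D D'\<rbrakk> \<Longrightarrow>
           \<phi> D (marked_bracket star a bullet D) = \<phi> D' (marked_bracket star a bullet D')"
  shows "\<exists>P\<phi> :: slices \<Rightarrow> 'a.
           (\<forall>D\<in>admissible_diagrams. P\<phi> D = \<phi> D (marked_bracket star a bullet D)) \<and>
           invariant_on admissible_diagrams (UNIV - {Gamma1}) P\<phi>"
proof (intro exI conjI ballI)
  interpret periodic_bracket_magma star a bullet
    by (intro periodic_bracket_magma.intro periodic_bracket_magma_axioms.intro assms(1,2))
  let ?Q = "marked_bracket star a bullet"
  let ?P = "\<lambda>D. \<phi> D (?Q D)"
  show "?P D = \<phi> D (?Q D)" for D ..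
  have "admissible_diagrams \<subseteq> marked_graph_diagrams"
    by (auto simp: admissible_diagrams_def)
  with marked_bracket_invariant
  have Q: "invariant_on admissible_diagrams (UNIV - {Gamma1, Gamma6, Gamma6'}) ?Q"
    unfolding invariant_on_def by blast
  have "?P D = ?P E"
    if "D \<in> admissible_diagrams" "E \<in> admissible_diagrams" "applied_once g D E" "g \<noteq> Gamma1"
    for g D E
  \<comment> \<open>For these two moves the compatibility hypothesis on \<open>\<phi>\<close> is the
    claim; for the others both \<open>\<phi>\<close> and its argument stay the same.\<close>
  proof (cases "g \<in> {Gamma6, Gamma6'}")
    case True
    with assms(5) that show ?thesis by blast
  next
    case False
    with assms(4) Q that have "\<phi> D = \<phi> E" "?Q D = ?Q E"
      unfolding invariant_on_def by blast+
    then show ?thesis by simp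
  qed
  moreover have "?P D = ?P E"
    if "D \<in> admissible_diagrams" "E \<in> admissible_diagrams" "planar_isotopic D E" for D E
    using assms(4) Q that unfolding invariant_on_def by metis
  ultimately show "invariant_on admissible_diagrams (UNIV - {Gamma1}) ?P"
    unfolding invariant_on_def by blast
qed

end
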